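(* For every positive integer $k$ and for every oriented graph $D$ with $\operatorname{inv}(D)\geq k+10$, there is a partition $(V_1, V_2)$ of $V(D)$ satisfying $\operatorname{inv}(D\langle V_1\rangle) \geq k$ and $\operatorname{inv}(D\langle V_2\rangle) \geq 1$.
   Context: All graphs are finite. An oriented graph is a digraph without loops and with at most one arc between any two vertices. For an oriented graph $D$ and $X\subseteq V(D)$, $D\langle X\rangle$ denotes the subdigraph of $D$ induced by $X$, and the inversion of $X$ in $D$ consists in reversing the direction of all arcs of $D\langle X\rangle$. For a finite family $(X_i)_{i\in I}$ of subsets of $V(D)$, $\operatorname{Inv}(D;(X_i)_{i\in I})$ is the oriented graph obtained by inverting the $X_i$ one after another (the order is irrelevant: an arc is reversed if and only if an odd number of the $X_i$ contain both its end-vertices). The family is a decycling family of $D$ if the resulting oriented graph is acyclic (has no directed cycle). The inversion number $\operatorname{inv}(D)$ is the minimum cardinality of a decycling family of $D$. *)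

theory Defs
  imports "Graph_Theory.Digraph_Component"
begin

locale oriented_graph = fin_digraph + loopfree_digraph +
  assumes at_most_one_arc:
    "\<lbrakk>e \<in> arcs G; e' \<in> arcs G; {tail G e, head G e} = {tail G e', head G e'}\<rbrakk> \<Longrightarrow> e = e'"

sublocale oriented_graph \<subseteq> digraph
  by unfold_locales (auto simp: arc_to_ends_def intro: at_most_one_arc)

text \<open>Arcs keep their identity: reversing an arc exchanges its tail and its head.\<close>

definition invert :: "'a set \<Rightarrow> ('a, 'b) pre_digraph \<Rightarrow> ('a, 'b) pre_digraph" where
  "invert X D = D\<lparr>
     tail := (\<lambda>e. if e \<in> arcs (D \<restriction> X) then head D e else tail D e),
     head := (\<lambda>e. if e \<in> arcs (D \<restriction> X) then tail D e else head D e)\<rparr>"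

text \<open>
  A finite family of vertex sets is a list, so repetitions are allowed and its cardinality is
  its length.
\<close>

definition invert_family :: "('a, 'b) pre_digraph \<Rightarrow> 'a set list \<Rightarrow> ('a, 'b) pre_digraph" where
  "invert_family D Xs = fold invert Xs D"

definition acyclic_digraph :: "('a, 'b) pre_digraph \<Rightarrow> bool" where
  "acyclic_digraph D \<longleftrightarrow> \<not> (\<exists>p. pre_digraph.cycle D p)"

definition decycling_family :: "('a, 'b) pre_digraph \<Rightarrow> 'a set list \<Rightarrow> bool" where
  "decycling_family D Xs \<longleftrightarrow>
     (\<forall>X \<in> set Xs. X \<subseteq> verts D) \<and> acyclic_digraph (invert_family D Xs)"

text \<open>
  The minimum is over a nonempty set for every oriented graph, see
  \<open>oriented_graph.ex_decycling_family\<close> below.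
\<close>

definition inversion_number :: "('a, 'b) pre_digraph \<Rightarrow> nat" where
  "inversion_number D = (LEAST n. \<exists>Xs. decycling_family D Xs \<and> length Xs = n)"

lemma verts_invert_family: "verts (invert_family D Xs) = verts D"
  and arcs_invert_family: "arcs (invert_family D Xs) = arcs D"
  unfolding invert_family_def by (induction Xs arbitrary: D) (auto simp: invert_def)

lemma invert_family_parity:
  fixes D :: "('a, 'b) pre_digraph" and Xs :: "'a set list"
  assumes "e \<in> arcs D"
  defines "rev_e \<equiv> odd (length (filter (\<lambda>X. tail D e \<in> X \<and> head D e \<in> X) Xs))"
  shows "tail (invert_family D Xs) e = (if rev_e then head D e else tail D e)"
    and "head (invert_family D Xs) e = (if rev_e then tail D e else head D e)"
proof -
  have "tail (invert_family D Xs) e = (if rev_e then head D e else tail D e) \<and>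
    head (invert_family D Xs) e = (if rev_e then tail D e else head D e)"
    unfolding rev_e_def invert_family_def using assms(1)
  proof (induction Xs arbitrary: D)
    case (Cons X Xs)
    have "e \<in> arcs (invert X D)" using Cons.prems by (simp add: invert_def)
    from Cons.IH[OF this] show ?case
      using Cons.prems by (auto simp: invert_def conj_commute)
  qed simp
  then show "tail (invert_family D Xs) e = (if rev_e then head D e else tail D e)"
    and "head (invert_family D Xs) e = (if rev_e then tail D e else head D e)" by auto
qed

lemma acyclic_digraphI:
  fixes f :: "'a \<Rightarrow> nat"
  assumes "\<And>e. e \<in> arcs D \<Longrightarrow> f (tail D e) < f (head D e)"
  shows "acyclic_digraph D"
proof -
  have *: "f u < f v" if "pre_digraph.cas D u p v" "set p \<subseteq> arcs D" "p \<noteq> []" for u v p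
    using that
  proof (induction p arbitrary: u)
    case (Cons e p)
    have lt: "f (tail D e) < f (head D e)" using Cons.prems assms by auto
    show ?case
    proof (cases "p = []")
      case True
      then show ?thesis using Cons.prems lt by (auto simp: pre_digraph.cas.simps)
    next
      case False
      then have "f (head D e) < f v"
        using Cons.IH[of "head D e"] Cons.prems by (auto simp: pre_digraph.cas.simps)
      then show ?thesis using Cons.prems lt by (auto simp: pre_digraph.cas.simps)
    qed
  qed auto
  show ?thesis
    unfolding acyclic_digraph_def pre_digraph.cycle_def pre_digraph.awalk_def
    using * by blast
qed

lemma (in oriented_graph) ex_decycling_family: "\<exists>Xs. decycling_family G Xs"
proof -
  obtain f :: "'a \<Rightarrow> nat" where f: "inj_on f (verts G)"
    using finite_imp_inj_to_nat_seg[OF finite_verts] by blast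
  define S where "S = (\<lambda>e. {tail G e, head G e}) ` {e \<in> arcs G. f (head G e) < f (tail G e)}"
  have "finite S" by (simp add: S_def)
  then obtain Xs where Xs: "set Xs = S" "distinct Xs"
    using finite_distinct_list by blast
  let ?H = "invert_family G Xs"
  have "f (tail ?H e) < f (head ?H e)" if e: "e \<in> arcs G" for e
  proof -
    let ?P = "\<lambda>X. tail G e \<in> X \<and> head G e \<in> X"
    have ne: "tail G e \<noteq> head G e" using e by (rule no_loops)
    have mem: "X \<in> S \<and> ?P X \<longleftrightarrow> X = {tail G e, head G e} \<and> f (head G e) < f (tail G e)" for X
    proof
      assume X: "X \<in> S \<and> ?P X"
      then obtain e' where e': "e' \<in> arcs G" "f (head G e') < f (tail G e')"
        "X = {tail G e', head G e'}" by (auto simp: S_def)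
      have "X = {tail G e, head G e}" using X e'(3) ne by auto
      moreover from this have "e = e'" using at_most_one_arc e e' by metis
      ultimately show "X = {tail G e, head G e} \<and> f (head G e) < f (tail G e)"
        using e' by simp
    qed (use e in \<open>auto simp: S_def\<close>)
    have "length (filter ?P Xs) = card {X. X \<in> S \<and> ?P X}"
      using Xs distinct_card[of "filter ?P Xs"] by simp
    also have "\<dots> = (if f (head G e) < f (tail G e) then 1 else 0)"
      unfolding mem by auto
    finally have len: "odd (length (filter ?P Xs)) \<longleftrightarrow> f (head G e) < f (tail G e)" by simp
    have "f (tail G e) \<noteq> f (head G e)"
      using ne e f by (auto dest: inj_onD)
    then show ?thesis using invert_family_parity[OF e, of Xs] len by auto
  qed
  then have "acyclic_digraph ?H" by (intro acyclic_digraphI) (auto simp: arcs_invert_family)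
  moreover have "\<forall>X \<in> set Xs. X \<subseteq> verts G" using Xs by (auto simp: S_def)
  ultimately show ?thesis unfolding decycling_family_def by blast
qed

end

theory Submission
  imports Defs
begin

text \<open>
  Deleting a set \<open>S\<close> of vertices between which there is no walk of length 1 or 2 decreases the
  inversion number by at most 2: since \<open>S\<close> is independent and no vertex has both an in- and an
  out-neighbour in \<open>S\<close>, inverting \<open>Y \<union> S\<close> and \<open>Y\<close>, where \<open>Y\<close> is the set of in-neighbours of
  \<open>S\<close>, turns all vertices of \<open>S\<close> into sources and changes no arc outside of \<open>S\<close>. A shortest
  directed cycle is the union of five such sets, because a walk of length at most 2 between two
  of its vertices cannot be a proper shortcut. Hence deleting a shortest directed cycle decreases
  the inversion number by at most 10.
\<close>

section \<open>Acyclicity, rankings and induced subgraphs\<close>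

lemma acyclic_imp_nat_ranking:
  assumes "finite R" "acyclic R"
  obtains f :: "'a \<Rightarrow> nat" where "\<And>x y. (x, y) \<in> R \<Longrightarrow> f x < f y"
proof
  fix x y assume xy: "(x, y) \<in> R"
  have fin: "finite {z. (z, y) \<in> R\<^sup>+}" for y
    by (rule finite_subset[of _ "Domain (R\<^sup>+)"])
      (auto intro: finite_Domain simp: assms(1) simp del: trancl_domain)
  \<comment> \<open>The ranking counts the \<open>R\<^sup>+\<close>-predecessors of a point. The
    inclusion is strict because \<open>x\<close> precedes \<open>y\<close> but, by acyclicity, not
    itself.\<close>
  have "{z. (z, x) \<in> R\<^sup>+} \<subset> {z. (z, y) \<in> R\<^sup>+}"
    using xy assms(2) by (auto simp: acyclic_def intro: trancl_into_trancl)
  then show "card {z. (z, x) \<in> R\<^sup>+} < card {z. (z, y) \<in> R\<^sup>+}"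
    by (rule psubset_card_mono[OF fin])
qed

text \<open>A closed walk contains a cycle, and a ranking that increases along arcs excludes cycles.
  This lets acyclicity be treated as a property of a relation on vertices.\<close>

lemma (in fin_digraph) acyclic_digraph_iff: "acyclic_digraph G \<longleftrightarrow> acyclic (arcs_ends G)"
proof
  assume *: "acyclic_digraph G"
  show "acyclic (arcs_ends G)"
    unfolding acyclic_def
  proof (intro allI notI)
    fix x assume "(x, x) \<in> (arcs_ends G)\<^sup>+"
    then obtain p where "closed_w p"
      unfolding reachable1_awalk closed_w_def by auto
    then show False
      using closed_w_imp_cycle * unfolding acyclic_digraph_def by blast
  qed
next
  assume "acyclic (arcs_ends G)"
  then obtain f :: "'a \<Rightarrow> nat" where "\<And>x y. (x, y) \<in> arcs_ends G \<Longrightarrow> f x < f y"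
    using acyclic_imp_nat_ranking[of "arcs_ends G"] by (auto simp: arcs_ends_def)
  then show "acyclic_digraph G"
    by (intro acyclic_digraphI[where f = f]) (auto simp: arcs_ends_conv)
qed

lemma arcs_ends_induce_subgraph: "arcs_ends (D \<restriction> W) = arcs_ends D \<inter> W \<times> W"
  by (auto simp: arcs_ends_conv)

lemma induce_subgraph_induce_subgraph: "U \<subseteq> W \<Longrightarrow> (D \<restriction> W) \<restriction> U = D \<restriction> U"
  by (auto simp: induce_subgraph_def)

lemma (in fin_digraph) fin_digraph_invert_family: "fin_digraph (invert_family G Xs)"
  by unfold_locales
    (auto simp: verts_invert_family arcs_invert_family invert_family_parity)

lemma (in oriented_graph) oriented_graph_induce_subgraph:
  assumes "W \<subseteq> verts G"
  shows "oriented_graph (G \<restriction> W)"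
proof -
  have "finite W" by (rule finite_subset[OF assms finite_verts])
  then show ?thesis
    by unfold_locales (auto dest: no_loops at_most_one_arc)
qed

lemma inversion_number_le: "decycling_family D Xs \<Longrightarrow> inversion_number D \<le> length Xs"
  unfolding inversion_number_def by (rule Least_le) auto

lemma (in oriented_graph) obtain_decycling_family:
  obtains Xs where "decycling_family G Xs" "length Xs = inversion_number G"
proof -
  have "\<exists>n Xs. decycling_family G Xs \<and> length Xs = n"
    using ex_decycling_family by auto
  from LeastI_ex[OF this] show thesis
    unfolding inversion_number_def[symmetric] using that by auto
qed

lemma (in oriented_graph) inversion_number_eq_0_iff:
  "inversion_number G = 0 \<longleftrightarrow> acyclic (arcs_ends G)"
proof -
  have *: "decycling_family G [] \<longleftrightarrow> acyclic (arcs_ends G)"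
    by (simp add: decycling_family_def invert_family_def acyclic_digraph_iff)
  obtain Xs where "decycling_family G Xs" "length Xs = inversion_number G"
    by (rule obtain_decycling_family)
  then show ?thesis
    using * inversion_number_le[of G "[]"] by auto
qed

text \<open>Two opposite arcs have the same set of ends, so they are one arc, which would then be a
  loop.\<close>

lemma (in oriented_graph) no_walk_2:
  assumes "(x, y) \<in> arcs_ends G" "(y, x) \<in> arcs_ends G"
  shows False
proof -
  obtain e e' where e: "e \<in> arcs G" "tail G e = x" "head G e = y"
    and e': "e' \<in> arcs G" "tail G e' = y" "head G e' = x"
    using assms by (auto simp: arcs_ends_conv)
  then have "e = e'" by (intro at_most_one_arc) auto
  then show False using e e' no_loops[of e] by simp
qed

section \<open>Cost of deleting vertex sets\<close>

lemma (in oriented_graph) inversion_number_delete_le: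
  assumes S: "S \<subseteq> verts G"
    and disj: "(arcs_ends G \<union> arcs_ends G O arcs_ends G) \<inter> S \<times> S = {}"
  shows "inversion_number G \<le> inversion_number (G \<restriction> (verts G - S)) + 2"
proof -
  let ?W = "verts G - S"
  interpret H: oriented_graph "G \<restriction> ?W"
    by (rule oriented_graph_induce_subgraph) auto
  obtain Xs where Xs: "decycling_family (G \<restriction> ?W) Xs"
    and len: "length Xs = inversion_number (G \<restriction> ?W)"
    by (rule H.obtain_decycling_family)
  have sub: "X \<subseteq> ?W" if "X \<in> set Xs" for X
    using Xs that by (auto simp: decycling_family_def)
  interpret I: fin_digraph "invert_family (G \<restriction> ?W) Xs"
    by (rule H.fin_digraph_invert_family)
  have "acyclic (arcs_ends (invert_family (G \<restriction> ?W) Xs))"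
    using Xs by (simp add: decycling_family_def I.acyclic_digraph_iff)
  then obtain f :: "'a \<Rightarrow> nat"
    where "\<And>x y. (x, y) \<in> arcs_ends (invert_family (G \<restriction> ?W) Xs) \<Longrightarrow> f x < f y"
    using acyclic_imp_nat_ranking[of "arcs_ends (invert_family (G \<restriction> ?W) Xs)"]
    by (auto simp: arcs_ends_def)
  then have f: "f (tail (invert_family (G \<restriction> ?W) Xs) e) < f (head (invert_family (G \<restriction> ?W) Xs) e)"
    if "e \<in> arcs (G \<restriction> ?W)" for e
    using that by (auto simp: arcs_ends_conv arcs_invert_family)
  define Y where "Y = {v \<in> ?W. \<exists>s\<in>S. (v, s) \<in> arcs_ends G}"
  define Zs where "Zs = (Y \<union> S) # Y # Xs"
  \<comment> \<open>Vertices of \<open>S\<close> are to become sources, so they get rank 0;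
    \<open>Suc\<close> lifts the ranking \<open>f\<close> of the remaining vertices above
    them.\<close>
  define h where "h = (\<lambda>v. if v \<in> S then 0 else Suc (f v))"
  have none: "filter (\<lambda>X. u \<in> X \<and> v \<in> X) Xs = []" if "u \<in> S \<or> v \<in> S" for u v
    using sub that by (auto simp: filter_empty_conv)
  have YS: "Y \<inter> S = {}" by (auto simp: Y_def)
  have "h (tail (invert_family G Zs) e) < h (head (invert_family G Zs) e)"
    if e: "e \<in> arcs G" for e
  proof -
    let ?t = "tail G e" and ?h = "head G e"
    have R: "(?t, ?h) \<in> arcs_ends G" using e by (auto simp: arcs_ends_conv)
    note parity = invert_family_parity[OF e, of Zs]
    consider "?t \<in> S" "?h \<in> S" | "?t \<in> S" "?h \<notin> S" | "?t \<notin> S" "?h \<in> S" | "?t \<notin> S" "?h \<notin> S"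
      by blast
    then show ?thesis
    proof cases
      case 1
      then show ?thesis using R disj by blast
    next
      case 2
      \<comment> \<open>If the head were in \<open>Y\<close>, the arc would extend to a walk of
        length 2 from \<open>S\<close> to \<open>S\<close>. So no set of \<open>Zs\<close> contains
        both ends, and the arc keeps leaving \<open>S\<close>.\<close>
      then have "?h \<notin> Y" using R disj by (auto simp: Y_def)
      then show ?thesis using 2 YS none parity by (auto simp: Zs_def h_def)
    next
      case 3
      \<comment> \<open>Only \<open>Y \<union> S\<close> contains both ends, so the arc is reversed
        exactly once and now leaves \<open>S\<close>.\<close>
      then have "?t \<in> Y" using R e by (auto simp: Y_def)
      moreover have "?h \<notin> Y" using 3 YS by auto
      ultimately show ?thesis using 3 none parity by (auto simp: Zs_def h_def)
    next
      case 4
      \<comment> \<open>Off \<open>S\<close>, the sets \<open>Y \<union> S\<close> and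
        \<open>Y\<close> have the same elements, so they cancel and only the parity in
        \<open>Xs\<close> counts.\<close>
      then have eW: "e \<in> arcs (G \<restriction> ?W)" using e by auto
      show ?thesis
        using 4 f[OF eW] parity invert_family_parity[OF eW, of Xs]
        by (auto simp: Zs_def h_def split: if_splits)
    qed
  qed
  then have "acyclic_digraph (invert_family G Zs)"
    by (intro acyclic_digraphI[where f = h]) (simp add: arcs_invert_family)
  moreover have "\<forall>X\<in>set Zs. X \<subseteq> verts G"
    using sub S by (auto simp: Zs_def Y_def)
  ultimately have "decycling_family G Zs"
    by (simp add: decycling_family_def)
  from inversion_number_le[OF this] show ?thesis
    by (simp add: Zs_def len)
qed

text \<open>The sets are deleted one at a time. They may overlap, so each step deletes only what is
  left of \<open>S n\<close>; the condition on walks survives because an induced subgraph has no new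
  walks.\<close>

lemma (in oriented_graph) inversion_number_delete_Union_le:
  assumes "\<And>c. S c \<subseteq> verts G"
    and "\<And>c. (arcs_ends G \<union> arcs_ends G O arcs_ends G) \<inter> S c \<times> S c = {}"
  shows "inversion_number G \<le> inversion_number (G \<restriction> (verts G - (\<Union>c<n. S c))) + 2 * n"
proof (induction n)
  case 0
  have "G \<restriction> verts G = G"
    unfolding induce_subgraph_def by (rule pre_digraph.equality) auto
  then show ?case by simp
next
  case (Suc n)
  define W T where "W = verts G - (\<Union>c<n. S c)" and "T = S n \<inter> W"
  interpret H: oriented_graph "G \<restriction> W"
    by (rule oriented_graph_induce_subgraph) (auto simp: W_def)
  let ?R = "arcs_ends G" and ?Q = "arcs_ends (G \<restriction> W)"
  have "?Q \<subseteq> ?R"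
    unfolding arcs_ends_induce_subgraph by (rule Int_lower1)
  then have "?Q \<union> ?Q O ?Q \<subseteq> ?R \<union> ?R O ?R"
    by (intro Un_mono relcomp_mono)
  moreover have "T \<times> T \<subseteq> S n \<times> S n" by (auto simp: T_def)
  ultimately have "(?Q \<union> ?Q O ?Q) \<inter> T \<times> T \<subseteq> (?R \<union> ?R O ?R) \<inter> S n \<times> S n"
    by (rule Int_mono)
  then have "(?Q \<union> ?Q O ?Q) \<inter> T \<times> T = {}"
    by (simp only: assms(2) subset_empty)
  moreover have "T \<subseteq> W" by (auto simp: T_def)
  ultimately have "inversion_number (G \<restriction> W) \<le> inversion_number ((G \<restriction> W) \<restriction> (W - T)) + 2"
    using H.inversion_number_delete_le[of T] by (simp only: induce_subgraph_verts)
  also have "(G \<restriction> W) \<restriction> (W - T) = G \<restriction> (W - T)"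
    by (rule induce_subgraph_induce_subgraph) auto
  also have "W - T = verts G - (\<Union>c<Suc n. S c)"
    by (auto simp: W_def T_def less_Suc_eq)
  finally show ?case using Suc.IH by (simp add: W_def)
qed

section \<open>Five colour classes on a shortest cycle\<close>

lemma mod_3_neq: "(j::nat) mod 3 \<noteq> Suc j mod 3" "j mod 3 \<noteq> Suc (Suc j) mod 3"
  by presburger+

lemma shortest_cycle_colouring:
  fixes R :: "'a rel"
  assumes "\<not> acyclic R" and no_2: "\<And>x y. (x, y) \<in> R \<Longrightarrow> (y, x) \<notin> R"
  obtains S :: "nat \<Rightarrow> 'a set" where
    "\<And>c. S c \<subseteq> Field R" "\<And>c. (R \<union> R O R) \<inter> S c \<times> S c = {}"
    "\<not> acyclic (R \<inter> (\<Union>c<5. S c) \<times> (\<Union>c<5. S c))"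
proof -
  define P where "P = (\<lambda>n. n > 0 \<and> (\<exists>x. (x, x) \<in> R ^^ n))"
  define g where "g = (LEAST n. P n)"
  have "\<exists>n. P n"
    using assms(1) by (auto simp: P_def acyclic_def trancl_power)
  then have "P g" unfolding g_def by (rule LeastI_ex)
  then obtain x where "g > 0" "(x, x) \<in> R ^^ g" by (auto simp: P_def)
  then obtain c where c: "c 0 = x" "c g = x" "\<And>i. i < g \<Longrightarrow> (c i, c (Suc i)) \<in> R"
    by (auto simp: relpow_fun_conv)
  have g_le: "g \<le> n" if "n > 0" "(y, y) \<in> R ^^ n" for n y
    unfolding g_def using that by (intro Least_le) (auto simp: P_def)
  \<comment> \<open>Loops are excluded too, by \<open>no_2\<close> with
    \<open>x = y\<close>.\<close>
  have g3: "g \<ge> 3"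
  proof (rule ccontr)
    assume "\<not> g \<ge> 3"
    then have "g = 1 \<or> g = 2" using \<open>g > 0\<close> by auto
    then show False
      using \<open>(x, x) \<in> R ^^ g\<close> no_2 by (fastforce simp: numeral_2_eq_2)
  qed
  have walk: "(c i, c j) \<in> R ^^ (j - i)" if "i \<le> j" "j \<le> g" for i j
    using that
  proof (induction j rule: dec_induct)
    case (step j)
    then have "(c i, c (Suc j)) \<in> R ^^ Suc (j - i)"
      using c(3)[of j] by auto
    then show ?case using step by (simp add: Suc_diff_le)
  qed auto
  \<comment> \<open>Vertices at cyclic distance 1 or 2 on the cycle have distinct colours.\<close>
  define col :: "nat \<Rightarrow> nat" where
    "col = (\<lambda>i. if i < g - 2 then i mod 3 else if i = g - 2 then 3 else 4)"
  define S where "S = (\<lambda>a. c ` {i. i < g \<and> col i = a})"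
  have no_shortcut: False
    if ij: "i < g" "j < g" "col i = col j" and l: "l = 1 \<or> l = 2" "(c j, c i) \<in> R ^^ l"
    for i j l
  proof -
    consider "i = j" | "i < j" | "j < i" by linarith
    then show False
    proof cases
      case 1
      then show False using g_le[of l] l g3 by auto
    next
      case 2
      \<comment> \<open>The shortcut closes the segment from \<open>c i\<close> to
        \<open>c j\<close>. Minimality of \<open>g\<close> then forces
        \<open>j - i \<ge> g - 2\<close>: the two vertices are close across the end of the cycle.
        Each such pair involves \<open>g - 2\<close> or \<open>g - 1\<close>, whose colours 3 and 4
        are used only once.\<close>
      have "(c i, c i) \<in> R ^^ (j - i + l)"
        using walk[of i j] l(2) 2 ij by (intro relpow_trans[of _ "c j"]) auto
      then have "g \<le> j - i + l" using l by (intro g_le) auto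
      then have "(i = 0 \<and> j = g - 2) \<or> (i = 0 \<and> j = g - 1) \<or> (i = 1 \<and> j = g - 1)"
        using l(1) ij(2) 2 by linarith
      then show False using ij(3) g3 2 by (auto simp: col_def split: if_splits)
    next
      case 3
      \<comment> \<open>Here the shortcut closes the path from \<open>c i\<close> through
        \<open>c g = c 0\<close> to \<open>c j\<close>, so minimality gives
        \<open>i - j \<le> l \<le> 2\<close>.\<close>
      have "(c i, c 0) \<in> R ^^ (g - i)" using walk[of i g] ij c by auto
      moreover have "(c 0, c j) \<in> R ^^ j" using walk[of 0 j] ij by auto
      ultimately have "(c i, c i) \<in> R ^^ (g - i + j + l)"
        using relpow_trans[OF relpow_trans] c(1,2) l(2) by metis
      then have "g \<le> g - i + j + l" using l by (intro g_le) auto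
      then have "i = Suc j \<or> i = Suc (Suc j)" using l(1) ij(1) 3 by linarith
      then have "j mod 3 \<noteq> i mod 3" using mod_3_neq by auto
      have lt3: "n mod 3 < 3" for n :: nat by simp
      consider "i < g - 2" | "i = g - 2" | "i = g - 1"
        using ij(1) by linarith
      then show False
      proof cases
        case 1
        then have "col i = i mod 3" "col j = j mod 3" using 3 by (simp_all add: col_def)
        then show False using ij(3) \<open>j mod 3 \<noteq> i mod 3\<close> by simp
      next
        case 2
        then have "col i = 3" "col j = j mod 3" using 3 by (simp_all add: col_def)
        then show False using ij(3) lt3[of j] by simp
      next
        case 3
        then have "g - 2 < i" using g3 by linarith
        then have "col i = 4" by (simp add: col_def)
        moreover have "col j \<le> 3" using 3 \<open>j < i\<close> lt3[of j] by (auto simp: col_def)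
        ultimately show False using ij(3) by simp
      qed
    qed
  qed
  have "S a \<subseteq> Field R" for a
    using c(3) by (auto simp: S_def Field_def)
  moreover have "(R \<union> R O R) \<inter> S a \<times> S a = {}" for a
  proof -
    have "(u, v) \<notin> R" "(u, v) \<notin> R O R" if uv: "u \<in> S a" "v \<in> S a" for u v
    proof -
      obtain j i where "i < g" "j < g" "col i = col j" "u = c j" "v = c i"
        using uv by (auto simp: S_def)
      then show "(u, v) \<notin> R" "(u, v) \<notin> R O R"
        using no_shortcut[of i j 1] no_shortcut[of i j 2] by (auto simp: numeral_2_eq_2)
    qed
    then show ?thesis by blast
  qed
  moreover have "\<not> acyclic (R \<inter> (\<Union>a<5. S a) \<times> (\<Union>a<5. S a))" (is "\<not> acyclic ?Q")
  proof -
    \<comment> \<open>The five classes cover the cycle, so all of its arcs survive in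
      \<open>?Q\<close>.\<close>
    have "col i < 5" for i by (auto simp: col_def intro: less_le_trans[of _ 3])
    then have U: "c i \<in> (\<Union>a<5. S a)" if "i < g" for i
      using that by (auto simp: S_def)
    moreover have "c (Suc i) \<in> (\<Union>a<5. S a)" if "i < g" for i
    proof (cases "Suc i = g")
      case True
      then show ?thesis using U[of 0] c \<open>g > 0\<close> by auto
    next
      case False
      then show ?thesis using U[of "Suc i"] that by auto
    qed
    ultimately have "(c 0, c g) \<in> ?Q ^^ g"
      using c(3) unfolding relpow_fun_conv by blast
    then have "(x, x) \<in> ?Q\<^sup>+"
      using c \<open>g > 0\<close> by (auto simp: trancl_power)
    then show ?thesis by (auto simp: acyclic_def)
  qed
  ultimately show thesis by (rule that[of S])
qed

theorem theorem1p14: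
  fixes k :: nat and D :: "('a, 'b) pre_digraph"
  assumes "k \<ge> 1"
    and "oriented_graph D"
    and "inversion_number D \<ge> k + 10"
  shows "\<exists>V1 V2. V1 \<union> V2 = verts D \<and> V1 \<inter> V2 = {} \<and>
           inversion_number (D \<restriction> V1) \<ge> k \<and> inversion_number (D \<restriction> V2) \<ge> 1"
proof -
  interpret oriented_graph D by (rule assms(2))
  have "\<not> acyclic (arcs_ends D)"
    using inversion_number_eq_0_iff assms(3) by auto
  then obtain S :: "nat \<Rightarrow> 'a set" where S: "\<And>c. S c \<subseteq> Field (arcs_ends D)"
    "\<And>c. (arcs_ends D \<union> arcs_ends D O arcs_ends D) \<inter> S c \<times> S c = {}"
    "\<not> acyclic (arcs_ends D \<inter> (\<Union>c<5. S c) \<times> (\<Union>c<5. S c))"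
    using shortest_cycle_colouring[of "arcs_ends D"] no_walk_2 by blast
  let ?U = "\<Union>c<5. S c"
  have "Field (arcs_ends D) \<subseteq> verts D" by (auto simp: Field_def arcs_ends_conv)
  then have sub: "S c \<subseteq> verts D" for c using S(1) by blast
  then have U: "?U \<subseteq> verts D" by blast
  interpret H: oriented_graph "D \<restriction> ?U" by (rule oriented_graph_induce_subgraph[OF U])
  have "inversion_number (D \<restriction> ?U) \<noteq> 0"
    using S(3) H.inversion_number_eq_0_iff by (simp add: arcs_ends_induce_subgraph)
  \<comment> \<open>Five deletions cost at most 2 each, which accounts for the 10.\<close>
  moreover have "inversion_number (D \<restriction> (verts D - ?U)) \<ge> k"
    using inversion_number_delete_Union_le[of S 5, OF sub S(2)] assms(3) by simp
  ultimately show ?thesis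
    using U by (intro exI[of _ "verts D - ?U"] exI[of _ ?U]) auto
qed

end
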